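(* Let $\Lambda_\oplus$ be the untyped probabilistic $\lambda$-calculus $M ::= x \mid MM \mid \lambda x.M \mid M\oplus M$, endowed with call-by-name semantics (evaluation contexts $E::=[\cdot]\mid EM$; $M\oplus N$ reduces to $M$ or $N$ each with probability $\frac12$; $(\lambda x.M)N$ reduces to $M\{N/x\}$), and let $\sum[\![M]\!]$ denote the probability of convergence of a closed term $M$. Let $\delta_{\text{cbn}}^c(M,N)=\sup_C |\sum[\![C[M]]\!]-\sum[\![C[N]]\!]|$ (supremum over $\Lambda_\oplus$ contexts) be the call-by-name context distance, and let $\delta_{\text{cbn}}$ be the call-by-name trace distance, defined equivalently by $$\delta_{\text{cbn}}(M,N)=\sup_{\mathsf T}\left|\mathrm{Pr}(M,\mathsf T)-\mathrm{Pr}(N,\mathsf T)\right|,$$ where traces are finite sequences $\mathsf T = N_1\cdots N_m\cdot\top$ of terms $N_i\in\Lambda_\oplus$ with free variables among $\{x\}$, and $\mathrm{Pr}(M, N_1\cdots N_m\cdot\top)=\sum[\![M\,(N_1\{M/x\})\cdots(N_m\{M/x\})]\!]$. Then $\delta_{\text{cbn}}^c$ and $\delta_{\text{cbn}}$ coincide.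
   Context: In the paper $\delta_{\text{cbn}}$ is originally defined as the greatest-lower-bound of $\varepsilon$ such that the states $(\{(\,[M^{\text{cbn}}],[\,]\,)^1\}, ([\sigma^{\text{cbn}}],[\,]))$ and the analogous one for $N$ are related by an $\varepsilon$-bisimulation in the deterministic weighted transition system of distributions of tuples restricted to a stable fragment of the tuple Markov chain; here $M^{\text{cbn}}$ is Girard's call-by-name translation into the linear calculus ($x\mapsto x$, $\lambda x.M\mapsto \lambda !x.M^{\text{cbn}}$, $MN\mapsto M^{\text{cbn}}\,!N^{\text{cbn}}$, $M\oplus N\mapsto M^{\text{cbn}}\oplus N^{\text{cbn}}$), $\sigma^{\text{cbn}}=\mu\alpha.(!\alpha\multimap\alpha)$, and the fragment only allows copying-and-evaluating the unique exponential component and then applying the resulting value to arguments that are translations of $\Lambda_\oplus$ terms. The paper shows this coincides with the trace formula given in the claim. *)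

theory Defs
  imports "HOL-Probability.SPMF"
begin

text \<open>Terms of \<open>\<Lambda>\<^sub>\<oplus>\<close> up to \<open>\<alpha>\<close>-equivalence, in de Bruijn notation.\<close>

datatype tm =
    Var nat
  | App tm tm
  | Lam tm
  | Choice tm tm

primrec fv :: "tm \<Rightarrow> nat set" where
  "fv (Var i) = {i}"
| "fv (App M N) = fv M \<union> fv N"
| "fv (Lam M) = {i. Suc i \<in> fv M}"
| "fv (Choice M N) = fv M \<union> fv N"

definition closed_tm :: "tm \<Rightarrow> bool" where
  "closed_tm M \<longleftrightarrow> fv M = {}"

primrec lift :: "nat \<Rightarrow> tm \<Rightarrow> tm" where
  "lift k (Var i) = (if i < k then Var i else Var (Suc i))"
| "lift k (App M N) = App (lift k M) (lift k N)"
| "lift k (Lam M) = Lam (lift (Suc k) M)"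
| "lift k (Choice M N) = Choice (lift k M) (lift k N)"

text \<open>\<open>subst k N M\<close> is \<open>M{N/k}\<close>; the binder of \<open>k\<close> disappears, so larger indices drop by one.\<close>

primrec subst :: "nat \<Rightarrow> tm \<Rightarrow> tm \<Rightarrow> tm" where
  "subst k N (Var i) = (if i < k then Var i else if i = k then N else Var (i - 1))"
| "subst k N (App M M') = App (subst k N M) (subst k N M')"
| "subst k N (Lam M) = Lam (subst (Suc k) (lift 0 N) M)"
| "subst k N (Choice M M') = Choice (subst k N M) (subst k N M')"

datatype ectx = EHole | EApp ectx tm

primrec efill :: "ectx \<Rightarrow> tm \<Rightarrow> tm" where
  "efill EHole M = M"
| "efill (EApp E N) M = App (efill E M) N"

inductive red :: "tm \<Rightarrow> tm pmf \<Rightarrow> bool" where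
  red_beta: "red (efill E (App (Lam M) N)) (return_pmf (efill E (subst 0 N M)))"
| red_choice: "red (efill E (Choice M N))
    (map_pmf (\<lambda>b. if b then efill E M else efill E N) (bernoulli_pmf (1 / 2)))"

text \<open>\<open>approx M D\<close>: the sub-distribution on values \<open>D\<close> is the outcome of a finite exploration of the
  evaluation of \<open>M\<close>, where \<open>return_pmf None\<close> is the empty sub-distribution. The semantics of \<open>M\<close>
  is the least upper bound of these approximations, which form a directed set.\<close>

inductive approx :: "tm \<Rightarrow> tm spmf \<Rightarrow> bool" where
  approx_empty: "approx M (return_pmf None)"
| approx_value: "approx (Lam M) (return_spmf (Lam M))"
| approx_red: "red M P \<Longrightarrow> (\<And>N. N \<in> set_pmf P \<Longrightarrow> approx N (D N)) \<Longrightarrow> approx M (bind_pmf P D)"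

definition sem :: "tm \<Rightarrow> tm spmf" where
  "sem M = lub_spmf {D. approx M D}"

definition prob_conv :: "tm \<Rightarrow> real" where
  "prob_conv M = weight_spmf (sem M)"

datatype ctx =
    Hole
  | CLam ctx
  | CAppL ctx tm
  | CAppR tm ctx
  | CChoiceL ctx tm
  | CChoiceR tm ctx

primrec fill :: "ctx \<Rightarrow> tm \<Rightarrow> tm" where
  "fill Hole M = M"
| "fill (CLam C) M = Lam (fill C M)"
| "fill (CAppL C N) M = App (fill C M) N"
| "fill (CAppR N C) M = App N (fill C M)"
| "fill (CChoiceL C N) M = Choice (fill C M) N"
| "fill (CChoiceR N C) M = Choice N (fill C M)"

text \<open>Both suprema below are over nonempty sets of reals in \<open>[0, 1]\<close>.\<close>

definition ctx_dist_cbn :: "tm \<Rightarrow> tm \<Rightarrow> real" where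
  "ctx_dist_cbn M N =
    (SUP C\<in>{C. closed_tm (fill C M) \<and> closed_tm (fill C N)}.
      \<bar>prob_conv (fill C M) - prob_conv (fill C N)\<bar>)"

text \<open>A trace \<open>N\<^sub>1 \<cdots> N\<^sub>m \<cdot> \<top>\<close> is represented by the list \<open>[N\<^sub>1, \<dots>, N\<^sub>m]\<close>, where the variable \<open>x\<close>
  is index \<open>0\<close>.\<close>

definition traces :: "tm list set" where
  "traces = {T. \<forall>L\<in>set T. fv L \<subseteq> {0}}"

definition trace_prob :: "tm \<Rightarrow> tm list \<Rightarrow> real" where
  "trace_prob M T = prob_conv (foldl App M (map (subst 0 M) T))"

definition trace_dist_cbn :: "tm \<Rightarrow> tm \<Rightarrow> real" where
  "trace_dist_cbn M N = (SUP T\<in>traces. \<bar>trace_prob M T - trace_prob N T\<bar>)"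

end

theory Submission
  imports Defs
begin

text \<open>A context filled with a closed term \<open>M\<close> is \<open>L{M/x}\<close> for a term \<open>L\<close> with at most the free
  variable \<open>x\<close>. Head reduction of \<open>L\<close> itself simulates that of \<open>L{M/x}\<close> and of \<open>L{N/x}\<close> in lockstep
  until it reaches an abstraction, where both converge, or a term \<open>x N\<^sub>1 \<dots> N\<^sub>m\<close>, which is the trace
  \<open>N\<^sub>1 \<cdots> N\<^sub>m \<cdot> \<top>\<close>. Hence \<open>n\<close> steps of \<open>L{M/x}\<close> converge with probability at most that of \<open>L{N/x}\<close> plus
  the trace distance. Conversely the trace \<open>N\<^sub>1 \<cdots> N\<^sub>m \<cdot> \<top>\<close> is realised by the context
  \<open>(\<lambda>x. x N\<^sub>1 \<dots> N\<^sub>m) [\<cdot>]\<close>.\<close>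

section \<open>Substitution\<close>

lemma lift_fresh: "\<forall>i\<in>fv M. i < k \<Longrightarrow> lift k M = M"
proof (induction M arbitrary: k)
  case (Lam M)
  then have "\<forall>i\<in>fv M. i < Suc k"
    by (auto simp: less_Suc_eq_0_disj) (metis mem_Collect_eq not0_implies_Suc)
  with Lam.IH show ?case by simp
qed auto

lemma lift_closed: "closed_tm M \<Longrightarrow> lift k M = M"
  by (simp add: closed_tm_def lift_fresh)

lemma subst_fresh: "\<forall>i\<in>fv M. i < k \<Longrightarrow> subst k N M = M"
proof (induction M arbitrary: k N)
  case (Lam M)
  then have "\<forall>i\<in>fv M. i < Suc k"
    by (auto simp: less_Suc_eq_0_disj) (metis mem_Collect_eq not0_implies_Suc)
  with Lam.IH show ?case by simp
qed auto

lemma subst_closed: "closed_tm M \<Longrightarrow> subst k N M = M"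
  by (simp add: closed_tm_def subst_fresh)

lemma subst_lift: "subst k N (lift k M) = M"
  by (induction M arbitrary: k N) auto

lemma subst_Suc_lift:
  assumes "closed_tm M" "i \<le> j"
  shows "subst (Suc j) M (lift i L) = lift i (subst j M L)"
  using assms(2) by (induction L arbitrary: i j) (auto simp: lift_closed[OF assms(1)])

text \<open>The general substitution lemma lifts \<open>M\<close> past the binder of
  \<open>i\<close>; a closed \<open>M\<close> is invariant under lifting and under substitution, so
  no shifts of \<open>M\<close> appear.\<close>

lemma subst_subst:
  assumes "closed_tm M" "i \<le> j"
  shows "subst j M (subst i Q P) = subst i (subst j M Q) (subst (Suc j) M P)"
  using assms(2)
  by (induction P arbitrary: i j Q)
    (auto simp: lift_closed[OF assms(1)] subst_closed[OF assms(1)] subst_Suc_lift[OF assms(1)])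

section \<open>Free variables under lifting and substitution\<close>

lemma fv_lift: "fv (lift k M) = {i \<in> fv M. i < k} \<union> Suc ` {i \<in> fv M. k \<le> i}"
proof (induction M arbitrary: k)
  case (Lam M)
  show ?case
    by (auto simp: Lam image_iff) (metis Suc_le_D Suc_le_mono)+
qed auto

lemma fv_subst_subset:
  "fv (subst k N M) \<subseteq> {i \<in> fv M. i < k} \<union> {i. k \<le> i \<and> Suc i \<in> fv M} \<union> fv N"
proof (induction M arbitrary: k N)
  case (Lam M)
  show ?case
    using Lam[of "Suc k" "lift 0 N"] by (fastforce simp: fv_lift)
next
  case (App M1 M2)
  show ?case using App[of k N] by auto
next
  case (Choice M1 M2)
  show ?case using Choice[of k N] by auto
qed auto

text \<open>Serves to pull closedness of a filled context back to \<open>ctx_tm\<close>: no variable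
  other than \<open>k\<close> can vanish.\<close>

lemma fv_subst_superset:
  "{i \<in> fv M. i < k} \<union> {i. k \<le> i \<and> Suc i \<in> fv M} \<subseteq> fv (subst k N M)"
proof (induction M arbitrary: k N)
  case (Lam M)
  show ?case
    using Lam[of "Suc k" "lift 0 N"] by fastforce
next
  case (App M1 M2)
  show ?case using App[of k N] by auto
next
  case (Choice M1 M2)
  show ?case using Choice[of k N] by auto
qed auto

lemma fv_foldl_App: "fv (foldl App M T) = fv M \<union> (\<Union>L\<in>set T. fv L)"
  by (induction T arbitrary: M) auto

lemma subst_foldl_App: "subst k N (foldl App M T) = foldl App (subst k N M) (map (subst k N) T)"
  by (induction T arbitrary: M) auto

text \<open>\<open>ctx_tm k C\<close> replaces the hole by the variable \<open>k\<close>, counted from outside of \<open>C\<close>. Filling may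
  capture variables, but the terms filled in are closed.\<close>

primrec ctx_tm :: "nat \<Rightarrow> ctx \<Rightarrow> tm" where
  "ctx_tm k Hole = Var k"
| "ctx_tm k (CLam C) = Lam (ctx_tm (Suc k) C)"
| "ctx_tm k (CAppL C N) = App (ctx_tm k C) (lift k N)"
| "ctx_tm k (CAppR N C) = App (lift k N) (ctx_tm k C)"
| "ctx_tm k (CChoiceL C N) = Choice (ctx_tm k C) (lift k N)"
| "ctx_tm k (CChoiceR N C) = Choice (lift k N) (ctx_tm k C)"

text \<open>The substitution cancels each \<open>lift\<close> that \<open>ctx_tm\<close> puts on a
  side term, and a closed \<open>M\<close> passes under binders unchanged.\<close>

lemma subst_ctx_tm: "closed_tm M \<Longrightarrow> subst k M (ctx_tm k C) = fill C M"
  by (induction C arbitrary: k) (auto simp: lift_closed subst_lift)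

lemma fv_ctx_tm:
  assumes "closed_tm M" "closed_tm (fill C M)"
  shows "fv (ctx_tm 0 C) \<subseteq> {0}"
proof
  fix i assume "i \<in> fv (ctx_tm 0 C)"
  \<comment> \<open>A positive index would survive the substitution, lowered by one, as a free
    variable of the closed \<open>fill C M\<close>.\<close>
  moreover have "{i. Suc i \<in> fv (ctx_tm 0 C)} = {}"
    using fv_subst_superset[of "ctx_tm 0 C" 0 M] assms
    by (auto simp: subst_ctx_tm closed_tm_def)
  ultimately show "i \<in> {0}" by (cases i) auto
qed

section \<open>One-step reduction as a function\<close>

text \<open>A term splits in at most one way into evaluation context and redex, so
  \<open>red\<close> is the graph of a partial function. \<open>None\<close> covers both
  abstractions and terms stuck at a head variable.\<close>

primrec step :: "tm \<Rightarrow> tm pmf option" where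
  "step (Var i) = None"
| "step (Lam M) = None"
| "step (App M N) = (case M of Lam B \<Rightarrow> Some (return_pmf (subst 0 N B))
    | _ \<Rightarrow> map_option (map_pmf (\<lambda>M'. App M' N)) (step M))"
| "step (Choice M N) = Some (map_pmf (\<lambda>b. if b then M else N) (bernoulli_pmf (1 / 2)))"

lemma step_App:
  "step M = Some P \<Longrightarrow> step (App M N) = Some (map_pmf (\<lambda>M'. App M' N) P)"
  by (cases M) auto

lemma step_App_cases:
  assumes "step (App M N) = Some P"
  obtains (beta) B where "M = Lam B" "P = return_pmf (subst 0 N B)"
    | (head) Q where "step M = Some Q" "P = map_pmf (\<lambda>M'. App M' N) Q"
  using assms by (cases M) auto

lemma red_imp_step: "red M P \<Longrightarrow> step M = Some P"
proof (induction rule: red.induct)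
  case (red_beta E M N)
  show ?case
  proof (induction E)
    case (EApp E L)
    then show ?case using step_App[OF EApp] by simp
  qed simp
next
  case (red_choice E M N)
  show ?case
  proof (induction E)
    case (EApp E L)
    then show ?case using step_App[OF EApp, of L]
      by (simp add: pmf.map_comp o_def if_distrib[of "\<lambda>M'. App M' L"] cong: if_cong)
  qed (simp cong: if_cong)
qed

lemma red_App: "red M P \<Longrightarrow> red (App M N) (map_pmf (\<lambda>M'. App M' N) P)"
proof (induction rule: red.induct)
  case (red_beta E A B)
  show ?case using red.red_beta[of "EApp E N" A B] by simp
next
  case (red_choice E A B)
  show ?case using red.red_choice[of "EApp E N" A B]
    by (simp add: pmf.map_comp o_def if_distrib[of "\<lambda>M'. App M' N"] cong: if_cong)
qed

lemma step_imp_red: "step M = Some P \<Longrightarrow> red M P"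
proof (induction M arbitrary: P)
  case (App M N)
  from App.prems show ?case
  proof (cases rule: step_App_cases)
    case (beta B)
    then show ?thesis using red.red_beta[of EHole B N] by simp
  next
    case (head Q)
    then show ?thesis using App.IH(1) red_App by blast
  qed
next
  case (Choice M N)
  then show ?case using red.red_choice[of EHole M N] by (simp cong: if_cong)
qed auto

section \<open>Branching, free variables and substitution along a step\<close>

lemma finite_set_step: "step M = Some P \<Longrightarrow> finite (set_pmf P)"
proof (induction M arbitrary: P)
  case (App M N)
  from App.prems show ?case
    by (cases rule: step_App_cases) (auto simp: App.IH(1))
qed auto

lemma step_fv: "step M = Some P \<Longrightarrow> L \<in> set_pmf P \<Longrightarrow> fv L \<subseteq> fv M"
proof (induction M arbitrary: P L)
  case (App M N)
  from App.prems(1) show ?case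
  proof (cases rule: step_App_cases)
    case (beta B)
    then show ?thesis using App.prems(2) fv_subst_subset[of 0 N B] by auto
  next
    case (head Q)
    then obtain L' where "L' \<in> set_pmf Q" "L = App L' N" using App.prems(2) by auto
    then show ?thesis using App.IH(1)[OF head(1)] by auto
  qed
qed (auto split: if_splits)

text \<open>Substitution commutes with beta by \<open>subst_subst\<close> and cannot disturb a redex
  at the head. The converse fails: a term stuck at variable \<open>k\<close> may reduce once
  \<open>M\<close> is put there.\<close>

lemma step_subst:
  assumes "closed_tm M"
  shows "step L = Some P \<Longrightarrow> step (subst k M L) = Some (map_pmf (subst k M) P)"
proof (induction L arbitrary: P)
  case (App A B)
  from App.prems show ?case
  proof (cases rule: step_App_cases)
    case (beta C)
    then show ?thesis using assms by (simp add: subst_subst lift_closed)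
  next
    case (head Q)
    show ?thesis using step_App[OF App.IH(1)[OF head(1)], of "subst k M B"]
      by (simp add: head(2) pmf.map_comp o_def)
  qed
next
  case (Choice A B)
  then show ?case by (auto simp: pmf.map_comp o_def if_distrib[of "subst k M"] cong: if_cong)
qed auto

lemma step_None_cases:
  assumes "step L = None"
  obtains (Lam) B where "L = Lam B" | (head) i T where "L = foldl App (Var i) T"
proof -
  from assms have "(\<exists>B. L = Lam B) \<or> (\<exists>i T. L = foldl App (Var i) T)"
  proof (induction L)
    case (Var i)
    have "Var i = foldl App (Var i) []" by simp
    then show ?case by blast
  next
    case (App A B)
    then have "step A = None" "\<nexists>C. A = Lam C" by (cases A; simp)+
    with App.IH obtain i T where "A = foldl App (Var i) T" by blast
    then have "App A B = foldl App (Var i) (T @ [B])" by simp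
    then show ?case by blast
  qed auto
  then show thesis using that by blast
qed

section \<open>Probability of convergence\<close>

text \<open>The number is fuel: when it runs out, the mass goes to \<open>None\<close>. Even
  returning an abstraction costs one unit.\<close>

primrec eval :: "nat \<Rightarrow> tm \<Rightarrow> tm spmf" where
  "eval 0 M = return_pmf None"
| "eval (Suc n) M = (case step M of Some P \<Rightarrow> bind_pmf P (eval n)
    | None \<Rightarrow> (case M of Lam B \<Rightarrow> return_spmf M | _ \<Rightarrow> return_pmf None))"

lemma approx_eval: "approx M (eval n M)"
proof (induction n arbitrary: M)
  case (Suc n)
  show ?case
  proof (cases "step M")
    case None
    then show ?thesis by (auto split: tm.splits intro: approx.intros)
  next
    case (Some P)
    then show ?thesis using approx_red[OF step_imp_red[OF Some], of "eval n"] Suc by simp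
  qed
qed (simp add: approx_empty)

lemma ord_spmf_bind_pmf:
  assumes "\<And>x. x \<in> set_pmf P \<Longrightarrow> ord_spmf (=) (f x) (g x)"
  shows "ord_spmf (=) (bind_pmf P f) (bind_pmf P g)"
  \<comment> \<open>The coupling records membership in the support, as the assumption holds only
    there.\<close>
  by (rule rel_pmf_bindI[where R = "\<lambda>x y. x = y \<and> x \<in> set_pmf P"])
    (auto intro: rel_pmf_reflI assms)

lemma eval_mono: "n \<le> m \<Longrightarrow> ord_spmf (=) (eval n M) (eval m M)"
proof (induction n arbitrary: m M)
  case (Suc n)
  then obtain m' where m: "m = Suc m'" "n \<le> m'" by (cases m) auto
  show ?case
  proof (cases "step M")
    case None
    then show ?thesis by (auto simp: m ord_spmf_reflI split: tm.splits)
  next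
    case (Some P)
    then show ?thesis using Suc.IH[OF m(2)] by (simp add: m(1) ord_spmf_bind_pmf)
  qed
qed simp

text \<open>A step has finitely many outcomes, so the fuel needed by the subtrees has a maximum; one
  more unit covers the root.\<close>

lemma approx_le_eval: "approx M D \<Longrightarrow> \<exists>n. ord_spmf (=) D (eval n M)"
proof (induction rule: approx.induct)
  case (approx_empty M)
  show ?case by simp
next
  case (approx_value M)
  have "ord_spmf (=) (return_spmf (Lam M)) (eval (Suc 0) (Lam M))" by simp
  then show ?case by blast
next
  case (approx_red M P D)
  have step: "step M = Some P" by (rule red_imp_step) fact
  from approx_red.IH obtain h
    where h: "\<And>N. N \<in> set_pmf P \<Longrightarrow> ord_spmf (=) (D N) (eval (h N) N)"
    by metis
  define n where "n = Max (h ` set_pmf P)"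
  have "ord_spmf (=) (D N) (eval n N)" if N: "N \<in> set_pmf P" for N
  proof -
    have "h N \<le> n"
      unfolding n_def using N finite_set_step[OF step] by auto
    then show ?thesis using h[OF N] eval_mono spmf.leq_trans by blast
  qed
  then have "ord_spmf (=) (bind_pmf P D) (eval (Suc n) M)"
    by (simp add: step ord_spmf_bind_pmf)
  then show ?case by blast
qed

text \<open>The \<open>eval n M\<close> are cofinal among the approximations, and
  \<open>lub_spmf\<close> depends only on pointwise suprema. They form a chain, which later lets
  weight commute with the least upper bound.\<close>

lemma sem_eq_lub_eval: "sem M = lub_spmf (range (\<lambda>n. eval n M))"
proof -
  have "(SUP p\<in>{D. approx M D}. ennreal (spmf p x)) = (SUP p\<in>range (\<lambda>n. eval n M). ennreal (spmf p x))"
    for x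
  proof (rule antisym)
    show "(SUP p\<in>{D. approx M D}. ennreal (spmf p x))
        \<le> (SUP p\<in>range (\<lambda>n. eval n M). ennreal (spmf p x))"
    proof (rule SUP_mono)
      fix D assume "D \<in> {D. approx M D}"
      then obtain n where "ord_spmf (=) D (eval n M)" using approx_le_eval by blast
      then show "\<exists>p\<in>range (\<lambda>n. eval n M). ennreal (spmf D x) \<le> ennreal (spmf p x)"
        by (auto intro!: bexI[of _ "eval n M"] ennreal_leI ord_spmf_eq_leD)
    qed
    show "(SUP p\<in>range (\<lambda>n. eval n M). ennreal (spmf p x))
        \<le> (SUP p\<in>{D. approx M D}. ennreal (spmf p x))"
      by (rule SUP_subset_mono) (auto simp: approx_eval)
  qed
  then show ?thesis by (simp add: sem_def lub_spmf_def)
qed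

section \<open>Convergence probability as a limit of weights\<close>

lemma weight_eval_mono: "n \<le> m \<Longrightarrow> weight_spmf (eval n M) \<le> weight_spmf (eval m M)"
  using ord_spmf_eqD_pmf_None[OF chain_empty eval_mono] by (simp add: weight_spmf_conv_pmf_None)

lemma bdd_above_weight: "bdd_above ((\<lambda>x. weight_spmf (f x)) ` A)"
  by (rule bdd_aboveI2[OF weight_spmf_le_1])

lemma prob_conv_SUP: "prob_conv M = (SUP n. weight_spmf (eval n M))"
proof -
  have "Complete_Partial_Order.chain (ord_spmf (=)) (range (\<lambda>n. eval n M))"
    by (rule chainI) (use eval_mono nat_le_linear in blast)
  then show ?thesis
    unfolding prob_conv_def sem_eq_lub_eval
    by (subst weight_lub_spmf) (auto simp: image_image)
qed

lemma weight_eval_le_prob_conv: "weight_spmf (eval n M) \<le> prob_conv M"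
  unfolding prob_conv_SUP by (rule cSUP_upper) (auto intro: bdd_above_weight)

lemma weight_eval_tendsto: "(\<lambda>n. weight_spmf (eval n M)) \<longlonglongrightarrow> prob_conv M"
  unfolding prob_conv_SUP
  by (rule LIMSEQ_incseq_SUP) (auto intro: bdd_above_weight weight_eval_mono simp: incseq_def)

lemma prob_conv_nonneg: "0 \<le> prob_conv M" and prob_conv_le_1: "prob_conv M \<le> 1"
  by (simp_all add: prob_conv_def weight_spmf_le_1)

lemma prob_conv_Lam: "prob_conv (Lam B) = 1"
  using weight_eval_le_prob_conv[of "Suc 0" "Lam B"] prob_conv_le_1[of "Lam B"] by simp

lemma weight_bind_pmf: "weight_spmf (bind_pmf P f) = (\<integral>x. weight_spmf (f x) \<partial>measure_pmf P)"
proof -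
  have "integrable (measure_pmf P) (\<lambda>x. pmf (f x) None)"
    by (rule measure_pmf.integrable_const_bound[where B = 1]) (auto simp: pmf_le_1)
  then show ?thesis by (simp add: weight_spmf_conv_pmf_None pmf_bind)
qed

lemma weight_eval_step:
  "step M = Some P \<Longrightarrow> weight_spmf (eval (Suc n) M) = (\<integral>L. weight_spmf (eval n L) \<partial>measure_pmf P)"
  by (simp add: weight_bind_pmf)

text \<open>Finite support turns the integral into a finite sum, through which the limit in the fuel
  passes.\<close>

lemma prob_conv_step:
  assumes "step M = Some P"
  shows "prob_conv M = (\<integral>L. prob_conv L \<partial>measure_pmf P)"
proof (rule LIMSEQ_unique)
  have sum: "(\<integral>L. f L \<partial>measure_pmf P) = (\<Sum>L\<in>set_pmf P. f L * pmf P L)" for f :: "tm \<Rightarrow> real"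
    by (rule integral_measure_pmf_real) (auto simp: finite_set_step[OF assms])
  show "(\<lambda>n. weight_spmf (eval (Suc n) M)) \<longlonglongrightarrow> prob_conv M"
    by (rule LIMSEQ_Suc[OF weight_eval_tendsto])
  show "(\<lambda>n. weight_spmf (eval (Suc n) M)) \<longlonglongrightarrow> (\<integral>L. prob_conv L \<partial>measure_pmf P)"
    unfolding weight_eval_step[OF assms] sum
    by (intro tendsto_intros weight_eval_tendsto)
qed

section \<open>The two distances\<close>

lemma abs_prob_conv_diff_le_1: "\<bar>prob_conv M - prob_conv N\<bar> \<le> 1"
  using prob_conv_nonneg[of M] prob_conv_le_1[of M] prob_conv_nonneg[of N] prob_conv_le_1[of N]
  by linarith

lemma abs_trace_prob_diff_le:
  "T \<in> traces \<Longrightarrow> \<bar>trace_prob M T - trace_prob N T\<bar> \<le> trace_dist_cbn M N"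
  unfolding trace_dist_cbn_def
  by (rule cSUP_upper) (auto intro!: bdd_aboveI2[where M = 1] simp: trace_prob_def abs_prob_conv_diff_le_1)

lemma trace_dist_nonneg: "0 \<le> trace_dist_cbn M N"
  using abs_trace_prob_diff_le[of "[]" M N] by (simp add: traces_def)

lemma trace_dist_commute: "trace_dist_cbn M N = trace_dist_cbn N M"
  by (simp add: trace_dist_cbn_def abs_minus_commute)

lemma abs_ctx_prob_diff_le:
  "closed_tm (fill C M) \<Longrightarrow> closed_tm (fill C N) \<Longrightarrow>
    \<bar>prob_conv (fill C M) - prob_conv (fill C N)\<bar> \<le> ctx_dist_cbn M N"
  unfolding ctx_dist_cbn_def
  by (rule cSUP_upper) (auto intro!: bdd_aboveI2[where M = 1] simp: abs_prob_conv_diff_le_1)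

text \<open>Only the \<open>M\<close> side is cut off at \<open>n\<close>, which drives the
  induction; the \<open>N\<close> side keeps its full convergence probability. The distance is paid
  at most once on each branch, at its end.\<close>

lemma weight_eval_subst_le:
  assumes M: "closed_tm M" and N: "closed_tm N" and "fv L \<subseteq> {0}"
  shows "weight_spmf (eval n (subst 0 M L)) \<le> prob_conv (subst 0 N L) + trace_dist_cbn M N"
  using assms(3)
proof (induction n arbitrary: L)
  case 0
  show ?case by (simp add: prob_conv_nonneg trace_dist_nonneg)
next
  case (Suc n)
  let ?\<delta> = "trace_dist_cbn M N"
  show ?case
  proof (cases "step L")
    case None
    then show ?thesis
    proof (cases rule: step_None_cases)
      case (Lam B)
      have "weight_spmf (eval (Suc n) (subst 0 M L)) \<le> 1" by (rule weight_spmf_le_1)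
      also have "\<dots> \<le> prob_conv (subst 0 N L) + ?\<delta>"
        by (simp add: Lam prob_conv_Lam trace_dist_nonneg)
      finally show ?thesis .
    next
      \<comment> \<open>The substituted terms are the trace \<open>T\<close> run on \<open>M\<close>
        and on \<open>N\<close>. They may go on reducing, but the trace distance bounds all that
        remains, so the induction ends here.\<close>
      case (head i T)
      then have "i = 0" "T \<in> traces"
        using Suc.prems by (auto simp: fv_foldl_App traces_def)
      then have "\<bar>prob_conv (subst 0 M L) - prob_conv (subst 0 N L)\<bar> \<le> ?\<delta>"
        using abs_trace_prob_diff_le[of T M N] by (simp add: head trace_prob_def subst_foldl_App)
      then show ?thesis using weight_eval_le_prob_conv[of "Suc n" "subst 0 M L"] by linarith
    qed
  next
    case (Some P)
    have fin: "integrable (measure_pmf P) f" for f :: "tm \<Rightarrow> real"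
      by (rule integrable_measure_pmf_finite[OF finite_set_step[OF Some]])
    have "weight_spmf (eval (Suc n) (subst 0 M L))
        = (\<integral>K. weight_spmf (eval n (subst 0 M K)) \<partial>measure_pmf P)"
      by (subst weight_eval_step[OF step_subst[OF M Some]]) simp
    also have "\<dots> \<le> (\<integral>K. prob_conv (subst 0 N K) + ?\<delta> \<partial>measure_pmf P)"
    proof (rule integral_mono_AE[OF fin fin], rule AE_pmfI)
      fix K assume "K \<in> set_pmf P"
      then have "fv K \<subseteq> {0}" using step_fv[OF Some] Suc.prems by blast
      then show "weight_spmf (eval n (subst 0 M K)) \<le> prob_conv (subst 0 N K) + ?\<delta>"
        by (rule Suc.IH)
    qed
    \<comment> \<open>\<open>P\<close> has total mass one, so averaging over the branches does not
      enlarge the error.\<close>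
    also have "\<dots> = (\<integral>K. prob_conv (subst 0 N K) \<partial>measure_pmf P) + ?\<delta>"
      by (simp add: fin)
    also have "(\<integral>K. prob_conv (subst 0 N K) \<partial>measure_pmf P) = prob_conv (subst 0 N L)"
      by (subst prob_conv_step[OF step_subst[OF N Some]]) simp
    finally show ?thesis .
  qed
qed

lemma prob_conv_subst_le:
  assumes "closed_tm M" "closed_tm N" "fv L \<subseteq> {0}"
  shows "prob_conv (subst 0 M L) \<le> prob_conv (subst 0 N L) + trace_dist_cbn M N"
  by (subst prob_conv_SUP, rule cSUP_least) (auto intro: weight_eval_subst_le[OF assms])

lemma ctx_dist_le_trace_dist:
  assumes "closed_tm M" "closed_tm N"
  shows "ctx_dist_cbn M N \<le> trace_dist_cbn M N"
  unfolding ctx_dist_cbn_def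
proof (rule cSUP_least)
  show "{C. closed_tm (fill C M) \<and> closed_tm (fill C N)} \<noteq> {}"
    using assms by (auto intro!: exI[of _ Hole])
next
  fix C assume "C \<in> {C. closed_tm (fill C M) \<and> closed_tm (fill C N)}"
  then have "fv (ctx_tm 0 C) \<subseteq> {0}" using fv_ctx_tm[OF assms(1)] by blast
  \<comment> \<open>The bound is one-sided, so it is applied with \<open>M\<close> and
    \<open>N\<close> exchanged as well.\<close>
  then show "\<bar>prob_conv (fill C M) - prob_conv (fill C N)\<bar> \<le> trace_dist_cbn M N"
    using prob_conv_subst_le[OF assms, of "ctx_tm 0 C"]
      prob_conv_subst_le[OF assms(2,1), of "ctx_tm 0 C"]
    by (simp add: subst_ctx_tm assms trace_dist_commute[of N M] abs_le_iff)
qed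

text \<open>A single beta step puts \<open>M\<close> at the head and, at once, for \<open>x\<close>
  in every argument of the trace.\<close>

lemma prob_conv_trace_ctx:
  "prob_conv (fill (CAppR (Lam (foldl App (Var 0) T)) Hole) M) = trace_prob M T"
  by (subst prob_conv_step) (auto simp: trace_prob_def subst_foldl_App)

lemma trace_dist_le_ctx_dist:
  assumes "closed_tm M" "closed_tm N"
  shows "trace_dist_cbn M N \<le> ctx_dist_cbn M N"
  unfolding trace_dist_cbn_def
proof (rule cSUP_least)
  have "[] \<in> traces" by (simp add: traces_def)
  then show "traces \<noteq> {}" by blast
next
  fix T assume T: "T \<in> traces"
  let ?C = "CAppR (Lam (foldl App (Var 0) T)) Hole"
  have "closed_tm (fill ?C L)" if "closed_tm L" for L
    using T that by (auto simp: closed_tm_def fv_foldl_App traces_def)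
  then show "\<bar>trace_prob M T - trace_prob N T\<bar> \<le> ctx_dist_cbn M N"
    using abs_ctx_prob_diff_le[of ?C M N] assms unfolding prob_conv_trace_ctx by blast
qed

theorem theorem7:
  fixes M N :: tm
  assumes "closed_tm M" and "closed_tm N"
  shows "ctx_dist_cbn M N = trace_dist_cbn M N"
  using ctx_dist_le_trace_dist[OF assms] trace_dist_le_ctx_dist[OF assms] by (rule antisym)

end
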